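(* Let $V$ be a finite set, let $\Sigma$ be the set of all mappings from $V$ to itself, let $\mu$ be a probability law on $\Sigma$ and let $\{X,N\}$ be a $\mu$-random walk. Suppose that the directed graph induced by $\mu$ is of constant outdegree, strongly-connected and aperiodic. Then the following three assertions are equivalent: (i) $\mathrm{Supp}(\mu)$ is synchronizing. (ii) The limit $\lim_{l\to-\infty} N_kN_{k-1}\cdots N_{l+1}$ exists a.s. for all $k\in\mathbb{Z}$. (iii) The $\mu$-random walk $\{X,N\}$ is strong.
   Context: $V$ is a finite (nonempty) set, $\Sigma$ is the finite semigroup (under composition) of all maps $V\to V$; $\sigma_2\sigma_1 x=\sigma_2(\sigma_1(x))$. Limits in $\Sigma$ are taken in the discrete topology. For a probability law $\mu$ on $\Sigma$, $\mathrm{Supp}(\mu)=\{\sigma\in\Sigma:\mu(\sigma)>0\}$. Directed graph induced by $\mu$: the pair $(V,A)$ with adjacency matrix $A(y,x)=\#\{\sigma\in\mathrm{Supp}(\mu):\sigma x=y\}$, $y,x\in V$ ($A(y,x)$ is the number of roads from $x$ to $y$). It is of constant outdegree if $\sum_{y}A(y,x)$ does not depend on $x$ (automatically true here); strongly-connected if for all $y,x\in V$ there is $n\ge1$ with $A^n(y,x)\ge1$; aperiodic if $\gcd\{n\ge1:A^n(x,x)\ge1\}=1$ for all $x\in V$. A $\mu$-random walk is a pair $\{X,N\}$ of processes $X=(X_k)_{k\in\mathbb{Z}}$ with values in $V$ and $N=(N_k)_{k\in\mathbb{Z}}$ with values in $\Sigma$, defined on a common probability space, such that: (1) for each $k\in\mathbb{Z}$,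 $N_k$ is independent of $\sigma(X_j,N_j:j\le k-1)$; (2) $(N_k)_{k\in\mathbb{Z}}$ is i.i.d. with common law $\mu$; (3) $X_k=N_kX_{k-1}$ a.s. for every $k\in\mathbb{Z}$. A $\mu$-random walk $\{X,N\}$ is strong if, for all $k\in\mathbb{Z}$, $X_k$ is a.s. measurable with respect to $\sigma(N_j:j\le k)$; equivalently, there are measurable maps $f_k:\Sigma^{\mathbb{N}}\to V$ with $X_k=f_k(N_k,N_{k-1},\ldots)$ a.s. for all $k\in\mathbb{Z}$. A subset $C\subset\Sigma$ is synchronizing if there is a finite sequence $(\sigma_p,\ldots,\sigma_1)$ of elements of $C$ such that the composition $\sigma_p\cdots\sigma_1$ maps $V$ onto a singleton. *)

theory Defs
  imports "HOL-Probability.Probability"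
begin

text \<open>
  The vertex set \<open>V\<close> is a type of class \<open>finite\<close>, the semigroup of maps \<open>V \<rightarrow> V\<close> is the type
  \<open>'v \<Rightarrow> 'v\<close> with \<open>\<circ>\<close>, and a probability law on it is a \<open>pmf\<close> whose support is \<open>set_pmf\<close>.
  Since \<open>V\<close> and \<open>V \<rightarrow> V\<close> are finite, they carry the discrete $\sigma$-algebra
  \<open>count_space UNIV\<close>.
\<close>

section \<open>The directed graph induced by a law\<close>

definition adjacency :: "('v::finite \<Rightarrow> 'v) pmf \<Rightarrow> nat ^ 'v ^ 'v" where
  "adjacency \<mu> = (\<chi> y x. card {\<sigma> \<in> set_pmf \<mu>. \<sigma> x = y})"

primrec matrix_power :: "'a::semiring_1 ^ 'v::finite ^ 'v \<Rightarrow> nat \<Rightarrow> 'a ^ 'v ^ 'v" where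
  "matrix_power A 0 = mat 1"
| "matrix_power A (Suc n) = A ** matrix_power A n"

text \<open>\<open>A $ y $ x\<close> counts the roads from \<open>x\<close> to \<open>y\<close>, so outdegrees are column sums.\<close>

definition constant_outdegree :: "nat ^ 'v::finite ^ 'v \<Rightarrow> bool" where
  "constant_outdegree A \<longleftrightarrow> (\<exists>d. \<forall>x. (\<Sum>y\<in>UNIV. A $ y $ x) = d)"

definition strongly_connected :: "nat ^ 'v::finite ^ 'v \<Rightarrow> bool" where
  "strongly_connected A \<longleftrightarrow> (\<forall>y x. \<exists>n\<ge>1. matrix_power A n $ y $ x \<ge> 1)"

definition aperiodic :: "nat ^ 'v::finite ^ 'v \<Rightarrow> bool" where
  "aperiodic A \<longleftrightarrow> (\<forall>x. Gcd {n. n \<ge> 1 \<and> matrix_power A n $ x $ x \<ge> 1} = 1)"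

section \<open>Compositions and synchronization\<close>

text \<open>The list \<open>[\<sigma>\<^sub>p, \<dots>, \<sigma>\<^sub>1]\<close> is sent to \<open>\<sigma>\<^sub>p \<circ> \<dots> \<circ> \<sigma>\<^sub>1\<close>: its last entry acts first.\<close>

definition compose_list :: "('v \<Rightarrow> 'v) list \<Rightarrow> 'v \<Rightarrow> 'v" where
  "compose_list \<sigma>s = foldr (\<circ>) \<sigma>s id"

definition synchronizing :: "('v \<Rightarrow> 'v) set \<Rightarrow> bool" where
  "synchronizing C \<longleftrightarrow>
     (\<exists>\<sigma>s. \<sigma>s \<noteq> [] \<and> set \<sigma>s \<subseteq> C \<and> (\<exists>v. range (compose_list \<sigma>s) = {v}))"

text \<open>\<open>N\<^sub>k \<circ> N\<^sub>k\<^sub>-\<^sub>1 \<circ> \<dots> \<circ> N\<^sub>l\<^sub>+\<^sub>1\<close>; the identity if \<open>l \<ge> k\<close>, which is irrelevant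
  for the limit \<open>l \<rightarrow> -\<infinity>\<close>.\<close>

definition walk_product :: "(int \<Rightarrow> 'w \<Rightarrow> 'v \<Rightarrow> 'v) \<Rightarrow> 'w \<Rightarrow> int \<Rightarrow> int \<Rightarrow> 'v \<Rightarrow> 'v" where
  "walk_product N \<omega> k l = compose_list (map (\<lambda>j. N j \<omega>) (rev [l+1..k]))"

section \<open>Random walks\<close>

text \<open>The $\sigma$-algebra on \<open>\<Omega>\<close> generated by the family \<open>(Z\<^sub>j)\<close>, \<open>j \<in> I\<close>, of maps into a discrete
  space. It is represented by a measure, of which only the underlying space and the measurable
  sets matter.\<close>

definition generated_algebra :: "'w set \<Rightarrow> 'i set \<Rightarrow> ('i \<Rightarrow> 'w \<Rightarrow> 's) \<Rightarrow> 'w measure" where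
  "generated_algebra \<Omega> I Z = sigma \<Omega> {Z j -` B \<inter> \<Omega> | j B. j \<in> I}"

locale random_walk = prob_space M
  for M :: "'w measure"
    and \<mu> :: "('v::finite \<Rightarrow> 'v) pmf"
    and X :: "int \<Rightarrow> 'w \<Rightarrow> 'v"
    and N :: "int \<Rightarrow> 'w \<Rightarrow> 'v \<Rightarrow> 'v" +
  assumes X_measurable: "\<And>k. X k \<in> measurable M (count_space UNIV)"
    and N_measurable: "\<And>k. N k \<in> measurable M (count_space UNIV)"
    and indep_past: "\<And>k. indep_set
          (sets (generated_algebra (space M) {k} N))
          (sets (generated_algebra (space M) {..k - 1} (\<lambda>j \<omega>. (X j \<omega>, N j \<omega>))))"
    and N_indep: "indep_vars (\<lambda>_. count_space UNIV) N UNIV"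
    and N_law: "\<And>k. distr M (count_space UNIV) (N k) = measure_pmf \<mu>"
    and step: "\<And>k. AE \<omega> in M. X k \<omega> = N k \<omega> (X (k - 1) \<omega>)"

definition strong ::
  "'w measure \<Rightarrow> (int \<Rightarrow> 'w \<Rightarrow> 'v) \<Rightarrow> (int \<Rightarrow> 'w \<Rightarrow> 'v \<Rightarrow> 'v) \<Rightarrow> bool" where
  "strong M X N \<longleftrightarrow>
     (\<forall>k. \<exists>Y \<in> measurable (generated_algebra (space M) {..k} N) (count_space UNIV).
        AE \<omega> in M. X k \<omega> = Y \<omega>)"

end

theory Submission
  imports Defs
begin

text \<open>
  A synchronizing word almost surely occurs in the past of every time, and from there on the products
  are constant in \<open>l\<close>; the constant is then \<open>X\<^sub>k\<close>, which makes the walk strong. Conversely, a limit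
  \<open>L\<close> satisfies \<open>L \<circ> \<sigma> = L\<close> for every \<open>\<sigma>\<close> in the support, because \<open>\<sigma>\<close> recurs infinitely often, and
  strong connectivity forces \<open>L\<close> to be constant; as a finite product of
  maps in the support, \<open>L\<close> shows that the support is synchronizing.

  If the walk is strong but the support is not synchronizing, approximate the event \<open>X\<^sub>0 = v\<close> by an
  event depending only on \<open>N\<^sub>l\<^sub>+\<^sub>1, \<dots>, N\<^sub>0\<close>. Given these maps, whose product is not constant, the
  independent value \<open>X\<^sub>l\<close> decides whether \<open>X\<^sub>0 = v\<close> as soon as \<open>v\<close> is in the range of the product. By
  aperiodicity \<open>X\<^sub>l\<close> takes every value with probability at least some \<open>\<epsilon> > 0\<close> that does not depend on
  \<open>l\<close>, so the error of the approximation is at least \<open>\<epsilon>\<^sup>2\<close>.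
\<close>

section \<open>Additive sets of natural numbers with gcd 1\<close>

text \<open>Meant for the lengths of the closed paths through a vertex, which are closed under
  addition and have gcd 1 by aperiodicity.\<close>

lemma numerical_semigroup_cofinite:
  fixes S :: "nat set"
  assumes add: "\<And>a b. a \<in> S \<Longrightarrow> b \<in> S \<Longrightarrow> a + b \<in> S" and "Gcd S = 1"
  shows "\<exists>n0. \<forall>n\<ge>n0. n \<in> S"
proof -
  define T where "T = insert 0 S"
  have T_add: "a + b \<in> T" if "a \<in> T" "b \<in> T" for a b
    using that add by (auto simp: T_def)
  have T_mult: "k * a \<in> T" if "a \<in> T" for k a
  proof (induction k)
    case 0
    show ?case by (simp add: T_def)
  next
    case (Suc k)
    then show ?case using T_add[OF that] by simp
  qed
  define D where "D d \<longleftrightarrow> d > 0 \<and> (\<exists>t\<in>T. t + d \<in> T)" for d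
  have "\<not> S \<subseteq> {0}"
    using \<open>Gcd S = 1\<close> by (metis Gcd_0_iff zero_neq_one)
  then obtain a where "a \<in> S" "a \<noteq> 0" by blast
  then have "D a" by (auto simp: D_def T_def)
  \<comment> \<open>The least positive difference \<open>d\<close> of two elements divides every element, so \<open>d = 1\<close>, and two
    consecutive elements generate all large numbers.\<close>
  define d where "d = (LEAST d. D d)"
  have "D d" using \<open>D a\<close> unfolding d_def by (rule LeastI)
  then obtain t where t: "t \<in> T" "t + d \<in> T" "d > 0" by (auto simp: D_def)
  have "d dvd n" if "n \<in> S" for n
  proof (rule ccontr)
    assume "\<not> d dvd n"
    then have "n mod d > 0" by (simp add: dvd_eq_mod_eq_0)
    \<comment> \<open>The elements \<open>(n div d) * (t + d)\<close> and
      \<open>n + (n div d) * t\<close> of \<open>T\<close> differ by \<open>n mod d\<close>, which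
      would be a positive difference smaller than \<open>d\<close>.\<close>
    moreover have "(n div d) * (t + d) + n mod d = n + (n div d) * t"
      by (simp add: algebra_simps)
    then have "(n div d) * (t + d) + n mod d \<in> T"
      using T_add[of n, OF _ T_mult[OF t(1)]] that by (simp add: T_def)
    ultimately have "D (n mod d)"
      using T_mult[OF t(2)] by (auto simp: D_def)
    then have "d \<le> n mod d" unfolding d_def by (rule Least_le)
    moreover have "n mod d < d" using t(3) by simp
    ultimately show False by simp
  qed
  then have "d dvd Gcd S" by (rule Gcd_greatest)
  with \<open>Gcd S = 1\<close> have "d = 1" by simp
  \<comment> \<open>The summand \<open>t * t\<close> ensures
    \<open>n mod t < t \<le> n div t\<close>; the extra 1 excludes \<open>n = 0\<close>, the only
    element of \<open>T\<close> that may lie outside \<open>S\<close>.\<close>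
  have "n \<in> S" if n: "n \<ge> t * t + 1" for n
  proof -
    have "n \<in> T"
    proof (cases "t = 0")
      case True
      then show ?thesis using T_mult[OF t(2), of n] \<open>d = 1\<close> by simp
    next
      case False
      have "t \<le> n div t"
        using n False by (metis add_leE div_le_mono nonzero_mult_div_cancel_left)
      moreover have "n mod t < t" using False by simp
      ultimately have le: "n mod t \<le> n div t" by linarith
      \<comment> \<open>Of the \<open>n div t\<close> copies of \<open>t\<close> that make up
        \<open>n\<close>, \<open>n mod t\<close> are enlarged to \<open>t + 1\<close> to absorb the
        remainder.\<close>
      have "(n div t - n mod t) * t + (n mod t) * (t + 1) =
          (n div t - n mod t + n mod t) * t + n mod t"
        by (simp only: algebra_simps)
      also have "\<dots> = n" using le by simp
      finally show ?thesis
        using T_add[OF T_mult[OF t(1)] T_mult[OF t(2)]] \<open>d = 1\<close> by metis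
    qed
    with n show ?thesis by (auto simp: T_def)
  qed
  then show ?thesis by blast
qed

section \<open>Reachability and aperiodicity\<close>

lemma compose_list_simps [simp]:
  "compose_list [] = id"
  "compose_list (\<sigma> # \<sigma>s) = \<sigma> \<circ> compose_list \<sigma>s"
  "compose_list (\<sigma>s @ \<tau>s) = compose_list \<sigma>s \<circ> compose_list \<tau>s"
proof -
  show "compose_list (\<sigma>s @ \<tau>s) = compose_list \<sigma>s \<circ> compose_list \<tau>s"
    by (induction \<sigma>s) (simp_all add: compose_list_def comp_assoc)
qed (simp_all add: compose_list_def)

text \<open>A path is recorded as the word of the maps along it, because such a word can later be
  read along \<open>N\<close> with positive probability.\<close>

definition reachable :: "('v \<Rightarrow> 'v) pmf \<Rightarrow> nat \<Rightarrow> 'v \<Rightarrow> 'v \<Rightarrow> bool" where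
  "reachable \<mu> n x y \<longleftrightarrow>
     (\<exists>\<sigma>s. length \<sigma>s = n \<and> set \<sigma>s \<subseteq> set_pmf \<mu> \<and> compose_list \<sigma>s x = y)"

lemma reachable_0 [simp]: "reachable \<mu> 0 x y \<longleftrightarrow> x = y"
  by (simp add: reachable_def)

lemma reachable_Suc:
  "reachable \<mu> (Suc n) x y \<longleftrightarrow> (\<exists>\<sigma>\<in>set_pmf \<mu>. \<exists>z. reachable \<mu> n x z \<and> \<sigma> z = y)"
proof
  assume "reachable \<mu> (Suc n) x y"
  then obtain \<sigma> \<sigma>s where "length \<sigma>s = n" "set (\<sigma> # \<sigma>s) \<subseteq> set_pmf \<mu>" "compose_list (\<sigma> # \<sigma>s) x = y"
    unfolding reachable_def length_Suc_conv by blast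
  then show "\<exists>\<sigma>\<in>set_pmf \<mu>. \<exists>z. reachable \<mu> n x z \<and> \<sigma> z = y"
    unfolding reachable_def by auto
next
  assume "\<exists>\<sigma>\<in>set_pmf \<mu>. \<exists>z. reachable \<mu> n x z \<and> \<sigma> z = y"
  then obtain \<sigma> \<sigma>s where "\<sigma> \<in> set_pmf \<mu>" "length \<sigma>s = n" "set \<sigma>s \<subseteq> set_pmf \<mu>"
      "\<sigma> (compose_list \<sigma>s x) = y"
    unfolding reachable_def by blast
  then show "reachable \<mu> (Suc n) x y"
    unfolding reachable_def by (intro exI[of _ "\<sigma> # \<sigma>s"]) auto
qed

lemma reachable_add:
  assumes "reachable \<mu> m x y" "reachable \<mu> n y z"
  shows "reachable \<mu> (n + m) x z"
proof -
  obtain \<sigma>s \<tau>s where "length \<sigma>s = m" "set \<sigma>s \<subseteq> set_pmf \<mu>" "compose_list \<sigma>s x = y"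
      "length \<tau>s = n" "set \<tau>s \<subseteq> set_pmf \<mu>" "compose_list \<tau>s y = z"
    using assms unfolding reachable_def by blast
  then show ?thesis
    unfolding reachable_def by (intro exI[of _ "\<tau>s @ \<sigma>s"]) auto
qed

text \<open>The entries are natural numbers, so nothing cancels: an entry of a product is positive
  exactly when one of its summands is.\<close>

lemma matrix_power_ge_1_iff_reachable:
  "matrix_power (adjacency \<mu>) n $ y $ x \<ge> 1 \<longleftrightarrow> reachable \<mu> n x y"
proof (induction n arbitrary: y)
  case 0
  then show ?case by (auto simp: mat_def)
next
  case (Suc n)
  have "adjacency \<mu> $ y $ z \<ge> 1 \<longleftrightarrow> (\<exists>\<sigma>\<in>set_pmf \<mu>. \<sigma> z = y)" for z
    by (auto simp: adjacency_def Suc_le_eq card_gt_0_iff)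
  then have "(\<exists>z. adjacency \<mu> $ y $ z \<ge> 1 \<and> matrix_power (adjacency \<mu>) n $ z $ x \<ge> 1)
      \<longleftrightarrow> reachable \<mu> (Suc n) x y"
    unfolding Suc reachable_Suc by blast
  then show ?case
    by (simp add: matrix_matrix_mult_def Suc_le_eq zero_less_iff_neq_zero del: neq0_conv)
qed

lemma strongly_connected_imp_reachable:
  assumes "strongly_connected (adjacency \<mu>)"
  shows "\<exists>n. reachable \<mu> n x y"
  using assms unfolding strongly_connected_def matrix_power_ge_1_iff_reachable by blast

text \<open>Closed paths at \<open>x\<close> exist in every large length. Following them by one path
  from \<open>x\<close> to \<open>y\<close> gives every large length from \<open>x\<close> to
  \<open>y\<close>, and there are only finitely many pairs; the sum of their thresholds serves as a
  common one.\<close>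

lemma ex_reachable_uniform:
  fixes \<mu> :: "('v::finite \<Rightarrow> 'v) pmf"
  assumes "strongly_connected (adjacency \<mu>)" "aperiodic (adjacency \<mu>)"
  shows "\<exists>n. \<forall>x y. reachable \<mu> n x y"
proof -
  have "\<exists>n0. \<forall>n\<ge>n0. reachable \<mu> n x y" for x y
  proof -
    let ?S = "{n. n \<ge> 1 \<and> reachable \<mu> n x x}"
    obtain a where a: "reachable \<mu> a x y"
      using strongly_connected_imp_reachable[OF assms(1)] by blast
    have "Gcd ?S = 1"
      using assms(2) unfolding aperiodic_def matrix_power_ge_1_iff_reachable by blast
    moreover have "b + c \<in> ?S" if "b \<in> ?S" "c \<in> ?S" for b c
      using that reachable_add[of \<mu> c x x b x] by simp
    ultimately obtain n0 where "\<forall>n\<ge>n0. n \<in> ?S"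
      using numerical_semigroup_cofinite[of ?S] by blast
    then have "reachable \<mu> (a + (n - a)) x y" if "n \<ge> n0 + a" for n
      using that a by (intro reachable_add) auto
    then show ?thesis by (intro exI[of _ "n0 + a"]) auto
  qed
  then obtain m where m: "\<And>x y n. n \<ge> m x y \<Longrightarrow> reachable \<mu> n x y" by metis
  have "m x y \<le> (\<Sum>(x, y)\<in>UNIV. m x y)" for x y
    using member_le_sum[of "(x, y)" UNIV "\<lambda>(x, y). m x y"] by simp
  with m show ?thesis by blast
qed

lemma limitin_discrete_topology_UNIV:
  "limitin (discrete_topology UNIV) f L F \<longleftrightarrow> eventually (\<lambda>x. f x = L) F"
proof
  assume "limitin (discrete_topology UNIV) f L F"
  then have "eventually (\<lambda>x. f x \<in> {L}) F" unfolding limitin_def by auto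
  then show "eventually (\<lambda>x. f x = L) F" by simp
next
  assume "eventually (\<lambda>x. f x = L) F"
  then show "limitin (discrete_topology UNIV) f L F"
    unfolding limitin_def by (auto elim: eventually_mono)
qed

section \<open>Words read along the walk\<close>

text \<open>The maps are kept as a list: the probability of a list factorizes, whereas different
  lists may have the same product.\<close>

definition word :: "(int \<Rightarrow> 'w \<Rightarrow> 'v \<Rightarrow> 'v) \<Rightarrow> 'w \<Rightarrow> int \<Rightarrow> int \<Rightarrow> ('v \<Rightarrow> 'v) list" where
  "word N \<omega> k l = map (\<lambda>j. N j \<omega>) (rev [l+1..k])"

lemma walk_product_word: "walk_product N \<omega> k l = compose_list (word N \<omega> k l)"
  by (simp add: walk_product_def word_def)

lemma length_word [simp]: "length (word N \<omega> k l) = nat (k - l)"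
  by (simp add: word_def)

lemma set_word: "set (word N \<omega> k l) = (\<lambda>j. N j \<omega>) ` {l<..k}"
  by (auto simp: word_def)

lemma word_same [simp]: "word N \<omega> l l = []"
  by (simp add: word_def)

lemma word_Cons: "l < k \<Longrightarrow> word N \<omega> k l = N k \<omega> # word N \<omega> (k - 1) l"
  by (simp add: word_def upto_rec2)

lemma word_append: "l \<le> m \<Longrightarrow> m \<le> k \<Longrightarrow> word N \<omega> k l = word N \<omega> k m @ word N \<omega> m l"
  using upto_split2[of "l + 1" m k] by (cases "l = m") (simp_all add: word_def)

lemma word_snoc: "l \<le> k \<Longrightarrow> word N \<omega> k (l - 1) = word N \<omega> k l @ [N l \<omega>]"
  by (simp add: word_append[of "l - 1" l k] word_Cons[of "l - 1" l])

lemma walk_product_comp: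
  "l \<le> m \<Longrightarrow> m \<le> k \<Longrightarrow> walk_product N \<omega> k l = walk_product N \<omega> k m \<circ> walk_product N \<omega> m l"
  by (simp add: walk_product_word word_append[of l m k])

lemma nth_word: "l < j \<Longrightarrow> j \<le> k \<Longrightarrow> word N \<omega> k l ! nat (k - j) = N j \<omega>"
  by (simp add: word_def rev_nth nat_less_iff)

section \<open>Generated sigma-algebras and measurability of words\<close>

lemma space_generated_algebra [simp]: "space (generated_algebra \<Omega> I Z) = \<Omega>"
  unfolding generated_algebra_def by (rule space_measure_of) auto

lemma sets_generated_algebra:
  "sets (generated_algebra \<Omega> I Z) = sigma_sets \<Omega> {Z j -` B \<inter> \<Omega> | j B. j \<in> I}"
  unfolding generated_algebra_def by (rule sets_measure_of) auto

lemma measurable_generated_algebra: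
  "j \<in> I \<Longrightarrow> Z j \<in> measurable (generated_algebra \<Omega> I Z) (count_space UNIV)"
  by (rule measurableI) (auto simp: sets_generated_algebra intro!: sigma_sets.Basic)

lemma sets_generated_algebra_mono:
  "I \<subseteq> J \<Longrightarrow> sets (generated_algebra \<Omega> I Z) \<subseteq> sets (generated_algebra \<Omega> J Z)"
  unfolding sets_generated_algebra by (rule sigma_sets_subseteq) blast

lemma sets_generated_algebra_subset:
  assumes "\<And>j. j \<in> I \<Longrightarrow> Z j \<in> measurable M (count_space UNIV)"
  shows "sets (generated_algebra (space M) I Z) \<subseteq> sets M"
  unfolding sets_generated_algebra
  using assms by (intro sets.sigma_sets_subset) (auto intro: measurable_sets)

text \<open>The measure \<open>G\<close> is left open so that the lemma serves for \<open>M\<close>,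
  for the past of the walk and for the sigma-algebra generated by \<open>N\<close> alone.\<close>

lemma measurable_word:
  fixes N :: "int \<Rightarrow> 'w \<Rightarrow> 'v::finite \<Rightarrow> 'v"
  assumes "\<And>j. l < j \<Longrightarrow> j \<le> k \<Longrightarrow> N j \<in> measurable G (count_space UNIV)"
  shows "(\<lambda>\<omega>. word N \<omega> k l) \<in> measurable G (count_space UNIV)"
proof (cases "l \<le> k")
  case True
  then show ?thesis using assms
  proof (induction k rule: int_ge_induct)
    case base
    show ?case by simp
  next
    case (step k)
    have IH [measurable]: "(\<lambda>\<omega>. word N \<omega> k l) \<in> measurable G (count_space UNIV)"
      by (rule step.IH) (auto intro: step.prems)
    have N [measurable]: "N (k + 1) \<in> measurable G (count_space UNIV)"
      using step by simp
    \<comment> \<open>Both the head and the tail take countably many values, and once both are fixed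
      the list is constant.\<close>
    have "(\<lambda>\<omega>. N (k + 1) \<omega> # word N \<omega> k l) \<in> measurable G (count_space UNIV)"
      by (rule measurable_compose_countable'[OF measurable_compose_countable'[OF _ IH] N, of "\<lambda>\<sigma> \<sigma>s \<omega>. \<sigma> # \<sigma>s"]) auto
    then show ?case using step by (simp add: word_Cons)
  qed
next
  case False
  then show ?thesis by (simp add: word_def)
qed

lemma walk_product_const:
  assumes "walk_product N \<omega> k l = (\<lambda>_. v)" "l' \<le> l" "l \<le> k"
  shows "walk_product N \<omega> k l' = (\<lambda>_. v)"
  using walk_product_comp[of l' l k N \<omega>] assms by (simp add: comp_def)

section \<open>The past of the walk and the probabilities of words\<close>

context random_walk
begin

text \<open>Time \<open>k\<close> is included, so the independence assumption at time
  \<open>k + 1\<close> is the one that concerns \<open>past k\<close>.\<close>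

definition past :: "int \<Rightarrow> 'w measure" where
  "past k = generated_algebra (space M) {..k} (\<lambda>j \<omega>. (X j \<omega>, N j \<omega>))"

lemma space_past [simp]: "space (past k) = space M"
  by (simp add: past_def)

lemma sets_past: "A \<in> sets (past k) \<Longrightarrow> A \<in> events"
  using indep_setD_ev2[OF indep_past[of "k + 1"]] by (auto simp: past_def)

lemma measurable_past:
  assumes "j \<le> k"
  shows "X j \<in> measurable (past k) (count_space UNIV)"
    and "N j \<in> measurable (past k) (count_space UNIV)"
proof -
  have *: "(\<lambda>\<omega>. (X j \<omega>, N j \<omega>)) \<in> measurable (past k) (count_space UNIV)"
    unfolding past_def using assms measurable_generated_algebra[where Z = "\<lambda>j \<omega>. (X j \<omega>, N j \<omega>)"]
    by auto
  show "X j \<in> measurable (past k) (count_space UNIV)"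
    using measurable_compose[OF *, of fst "count_space UNIV"] by simp
  show "N j \<in> measurable (past k) (count_space UNIV)"
    using measurable_compose[OF *, of snd "count_space UNIV"] by simp
qed

lemma sets_past_mono: "A \<in> sets (past j) \<Longrightarrow> j \<le> k \<Longrightarrow> A \<in> sets (past k)"
  unfolding past_def by (rule subsetD[OF sets_generated_algebra_mono]) auto

lemma word_measurable_past:
  "k \<le> m \<Longrightarrow> (\<lambda>\<omega>. word N \<omega> k l) \<in> measurable (past m) (count_space UNIV)"
  by (intro measurable_word measurable_past) auto

lemma word_measurable [measurable]: "(\<lambda>\<omega>. word N \<omega> k l) \<in> measurable M (count_space UNIV)"
  by (intro measurable_word N_measurable)

declare X_measurable [measurable]

lemma prob_N: "prob {\<omega> \<in> space M. N k \<omega> = \<sigma>} = pmf \<mu> \<sigma>"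
proof -
  have "pmf \<mu> \<sigma> = measure (distr M (count_space UNIV) (N k)) {\<sigma>}"
    by (simp add: N_law pmf.rep_eq)
  also have "\<dots> = prob (N k -` {\<sigma>} \<inter> space M)"
    by (rule measure_distr[OF N_measurable]) simp
  also have "N k -` {\<sigma>} \<inter> space M = {\<omega> \<in> space M. N k \<omega> = \<sigma>}" by auto
  finally show ?thesis by simp
qed

text \<open>The head of the list is the newest map, hence independent of \<open>A\<close> together
  with the rest of the word. The event \<open>A\<close> is carried along so that the word can be
  combined with a value of \<open>X l\<close> or with earlier words.\<close>

lemma prob_word:
  assumes "A \<in> sets (past l)"
  shows "prob (A \<inter> {\<omega> \<in> space M. word N \<omega> (l + int (length \<sigma>s)) l = \<sigma>s}) =
    prob A * prod_list (map (pmf \<mu>) \<sigma>s)"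
proof (induction \<sigma>s)
  case Nil
  have "A \<subseteq> space M" using sets_past[OF assms] sets.sets_into_space by blast
  then have "A \<inter> space M = A" by blast
  then show ?case by simp
next
  case (Cons \<sigma> \<sigma>s)
  let ?k = "l + int (length \<sigma>s)"
  let ?A = "A \<inter> {\<omega> \<in> space M. word N \<omega> ?k l = \<sigma>s}"
  have word_Suc: "word N \<omega> (l + int (length (\<sigma> # \<sigma>s))) l = N (?k + 1) \<omega> # word N \<omega> ?k l" for \<omega>
    using word_Cons[of l "?k + 1" N \<omega>] by (simp add: ac_simps)
  have "{\<omega> \<in> space (past ?k). word N \<omega> ?k l = \<sigma>s} \<in> sets (past ?k)"
    using word_measurable_past[of ?k ?k l] by measurable
  then have "?A \<in> sets (past ?k)"
    using sets_past_mono[OF assms, of ?k] by auto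
  moreover have "{\<omega> \<in> space M. N (?k + 1) \<omega> = \<sigma>} \<in> sets (generated_algebra (space M) {?k + 1} N)"
    using measurable_generated_algebra[of "?k + 1" "{?k + 1}" N "space M"]
    by (simp add: sets_generated_algebra) (auto intro!: sigma_sets.Basic)
  ultimately have "prob ({\<omega> \<in> space M. N (?k + 1) \<omega> = \<sigma>} \<inter> ?A) = pmf \<mu> \<sigma> * prob ?A"
    using indep_setD[OF indep_past[of "?k + 1"]] by (simp add: past_def prob_N)
  moreover have "{\<omega> \<in> space M. N (?k + 1) \<omega> = \<sigma>} \<inter> ?A =
      A \<inter> {\<omega> \<in> space M. word N \<omega> (l + int (length (\<sigma> # \<sigma>s))) l = \<sigma> # \<sigma>s}"
    unfolding word_Suc by auto
  ultimately show ?case using Cons by simp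
qed

text \<open>The \<open>n\<close> windows lie end to end, so the last one is independent of the event
  that all earlier ones miss the word, and contributes one more factor.\<close>

lemma prob_no_word:
  fixes l :: int and \<sigma>s :: "('v \<Rightarrow> 'v) list"
  defines "p \<equiv> int (length \<sigma>s)"
  shows "prob {\<omega> \<in> space M. \<forall>i<n. word N \<omega> (l + int i * p + p) (l + int i * p) \<noteq> \<sigma>s} =
    (1 - prod_list (map (pmf \<mu>) \<sigma>s)) ^ n"
proof (induction n)
  case 0
  show ?case by (simp add: prob_space)
next
  case (Suc n)
  define E where "E n = {\<omega> \<in> space M. \<forall>i<n. word N \<omega> (l + int i * p + p) (l + int i * p) \<noteq> \<sigma>s}" for n :: nat
  let ?l = "l + int n * p"
  let ?W = "{\<omega> \<in> space M. word N \<omega> (?l + p) ?l = \<sigma>s}"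
  have "int i * p + p \<le> int n * p" if "i < n" for i
    using mult_right_mono[of "int i + 1" "int n" p] that by (simp add: p_def algebra_simps)
  then have [measurable]: "(\<lambda>\<omega>. word N \<omega> (l + int i * p + p) (l + int i * p)) \<in> measurable (past ?l) (count_space UNIV)"
    if "i < n" for i
    using that by (intro word_measurable_past) auto
  have "E n = {\<omega> \<in> space (past ?l). \<forall>i\<in>{..<n}. word N \<omega> (l + int i * p + p) (l + int i * p) \<noteq> \<sigma>s}"
    by (auto simp: E_def)
  also have "\<dots> \<in> sets (past ?l)"
    by measurable
  finally have E: "E n \<in> sets (past ?l)" .
  have "E (Suc n) = E n - E n \<inter> ?W"
    by (auto simp: E_def less_Suc_eq)
  moreover have "?W \<in> events" by measurable
  ultimately have "prob (E (Suc n)) = prob (E n) - prob (E n \<inter> ?W)"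
    using sets_past[OF E] by (simp add: finite_measure_Diff)
  also have "\<dots> = prob (E n) * (1 - prod_list (map (pmf \<mu>) \<sigma>s))"
    using prob_word[OF E, of \<sigma>s] by (simp add: p_def algebra_simps)
  finally show ?case using Suc by (simp add: E_def)
qed

lemma prod_list_pmf_pos: "set \<sigma>s \<subseteq> set_pmf \<mu> \<Longrightarrow> prod_list (map (pmf \<mu>) \<sigma>s) > 0"
  by (induction \<sigma>s) (auto simp: pmf_positive)

text \<open>The product is itself a probability, by \<open>prob_word\<close> for the sure
  event.\<close>

lemma prod_list_pmf_le_1: "prod_list (map (pmf \<mu>) \<sigma>s) \<le> 1"
  using prob_word[OF sets.top, of 0 \<sigma>s] by (simp add: prob_space) (metis prob_le_1)

lemma AE_word_occurs:
  assumes "set \<sigma>s \<subseteq> set_pmf \<mu>"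
  shows "AE \<omega> in M. \<exists>l. l + int (length \<sigma>s) \<le> m \<and> word N \<omega> (l + int (length \<sigma>s)) l = \<sigma>s"
proof -
  let ?p = "int (length \<sigma>s)"
  let ?c = "prod_list (map (pmf \<mu>) \<sigma>s)"
  let ?B = "{\<omega> \<in> space M. \<forall>l. l + ?p \<le> m \<longrightarrow> word N \<omega> (l + ?p) l \<noteq> \<sigma>s}"
  have B: "?B \<in> events" by measurable
  have "prob ?B \<le> (1 - ?c) ^ n" for n
  proof -
    \<comment> \<open>With this start the last of the \<open>n\<close> windows ends exactly at
      \<open>m\<close>.\<close>
    let ?l = "m - int n * ?p"
    have "?l + int i * ?p + ?p \<le> m" if "i < n" for i
      using mult_right_mono[of "int i + 1" "int n" ?p] that by (simp add: algebra_simps)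
    then have "?B \<subseteq> {\<omega> \<in> space M. \<forall>i<n. word N \<omega> (?l + int i * ?p + ?p) (?l + int i * ?p) \<noteq> \<sigma>s}"
      by blast
    then have "prob ?B \<le> prob {\<omega> \<in> space M. \<forall>i<n. word N \<omega> (?l + int i * ?p + ?p) (?l + int i * ?p) \<noteq> \<sigma>s}"
      by (intro finite_measure_mono) measurable
    then show ?thesis by (simp only: prob_no_word)
  qed
  moreover have "(\<lambda>n. (1 - ?c) ^ n) \<longlonglongrightarrow> 0"
    using prod_list_pmf_pos[OF assms] prod_list_pmf_le_1[of \<sigma>s] by (intro LIMSEQ_power_zero) auto
  ultimately have "prob ?B \<le> 0" by (intro LIMSEQ_le_const) auto
  then have "prob ?B = 0" by (simp add: measure_le_0_iff)
  then have "AE \<omega> in M. \<omega> \<notin> ?B" using prob_eq_0[OF B] by simp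
  then show ?thesis by (rule AE_mp) (auto intro!: AE_I2)
qed

lemma AE_N_in_set_pmf: "AE \<omega> in M. \<forall>k. N k \<omega> \<in> set_pmf \<mu>"
  unfolding AE_all_countable
proof
  fix k :: int
  have "AE \<sigma> in distr M (count_space UNIV) (N k). \<sigma> \<in> set_pmf \<mu>"
    unfolding N_law by (rule AE_measure_pmf)
  then show "AE \<omega> in M. N k \<omega> \<in> set_pmf \<mu>" by (rule AE_distrD[OF N_measurable])
qed

text \<open>The exceptional sets of the countably many steps are merged first, so that one null set
  serves all pairs of times.\<close>

lemma AE_X_walk_product: "AE \<omega> in M. \<forall>k. \<forall>l\<le>k. X k \<omega> = walk_product N \<omega> k l (X l \<omega>)"
proof -
  have "AE \<omega> in M. \<forall>k. X k \<omega> = N k \<omega> (X (k - 1) \<omega>)"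
    unfolding AE_all_countable using step by blast
  then show ?thesis
  proof (rule AE_mp, intro AE_I2 impI allI)
    fix \<omega> and k l :: int
    assume *: "\<forall>k. X k \<omega> = N k \<omega> (X (k - 1) \<omega>)"
    assume "l \<le> k"
    then show "X k \<omega> = walk_product N \<omega> k l (X l \<omega>)"
    proof (induction k rule: int_ge_induct)
      case base
      then show ?case by (simp add: walk_product_word)
    next
      case (step k)
      then show ?case using *[rule_format, of "k + 1"]
        by (simp add: walk_product_word word_Cons)
    qed
  qed
qed

section \<open>Synchronization, limits and strong walks\<close>

lemma AE_walk_product_const:
  assumes "synchronizing (set_pmf \<mu>)"
  shows "AE \<omega> in M. \<exists>l\<le>k. \<exists>v. walk_product N \<omega> k l = (\<lambda>_. v)"
proof -
  obtain \<sigma>s v where "set \<sigma>s \<subseteq> set_pmf \<mu>" and "range (compose_list \<sigma>s) = {v}"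
    using assms unfolding synchronizing_def by blast
  then have const: "compose_list \<sigma>s = (\<lambda>_. v)"
    unfolding fun_eq_iff by (metis rangeI singletonD)
  show ?thesis
    using AE_word_occurs[OF \<open>set \<sigma>s \<subseteq> set_pmf \<mu>\<close>, of k]
  proof (rule AE_mp, intro AE_I2 impI)
    fix \<omega>
    assume "\<exists>l. l + int (length \<sigma>s) \<le> k \<and> word N \<omega> (l + int (length \<sigma>s)) l = \<sigma>s"
    then obtain l where l: "l + int (length \<sigma>s) \<le> k" "word N \<omega> (l + int (length \<sigma>s)) l = \<sigma>s"
      by blast
    have "walk_product N \<omega> k l = walk_product N \<omega> k (l + int (length \<sigma>s)) \<circ> compose_list \<sigma>s"
      using walk_product_comp[of l "l + int (length \<sigma>s)" k N \<omega>] l by (simp add: walk_product_word)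
    then have "walk_product N \<omega> k l = (\<lambda>_. walk_product N \<omega> k (l + int (length \<sigma>s)) v)"
      by (simp add: const comp_def)
    then show "\<exists>l\<le>k. \<exists>v. walk_product N \<omega> k l = (\<lambda>_. v)"
      using l(1) by (intro exI[of _ l]) auto
  qed
qed

lemma synchronizing_imp_limit:
  assumes "synchronizing (set_pmf \<mu>)"
  shows "AE \<omega> in M. \<exists>L. limitin (discrete_topology UNIV) (walk_product N \<omega> k) L at_bot"
  using AE_walk_product_const[OF assms, of k]
proof (rule AE_mp, intro AE_I2 impI)
  fix \<omega>
  assume "\<exists>l\<le>k. \<exists>v. walk_product N \<omega> k l = (\<lambda>_. v)"
  then obtain l v where lv: "l \<le> k" "walk_product N \<omega> k l = (\<lambda>_. v)" by blast
  have "walk_product N \<omega> k l' = (\<lambda>_. v)" if "l' \<le> l" for l'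
    by (rule walk_product_const[OF lv(2) that lv(1)])
  then show "\<exists>L. limitin (discrete_topology UNIV) (walk_product N \<omega> k) L at_bot"
    unfolding limitin_discrete_topology_UNIV eventually_at_bot_linorder
    by (intro exI[of _ "\<lambda>_. v"] exI[of _ l]) simp
qed

lemma limit_imp_synchronizing:
  assumes "strongly_connected (adjacency \<mu>)"
    and "AE \<omega> in M. \<exists>L. limitin (discrete_topology UNIV) (walk_product N \<omega> k) L at_bot"
  shows "synchronizing (set_pmf \<mu>)"
proof -
  have "AE \<omega> in M. \<forall>\<sigma>\<in>set_pmf \<mu>. \<forall>m. \<exists>l\<le>m. N l \<omega> = \<sigma>"
  proof (intro AE_ball_countable' countable_set_pmf)
    fix \<sigma> assume "\<sigma> \<in> set_pmf \<mu>"
    then have "AE \<omega> in M. \<exists>l. l + 1 \<le> m \<and> word N \<omega> (l + 1) l = [\<sigma>]" for m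
      using AE_word_occurs[of "[\<sigma>]" m] by simp
    then have "AE \<omega> in M. \<forall>m. \<exists>l. l + 1 \<le> m \<and> word N \<omega> (l + 1) l = [\<sigma>]"
      unfolding AE_all_countable by blast
    then show "AE \<omega> in M. \<forall>m. \<exists>l\<le>m. N l \<omega> = \<sigma>"
      by (rule AE_mp) (auto intro!: AE_I2 simp: word_Cons)
  qed
  then have "AE \<omega> in M. (\<exists>L. limitin (discrete_topology UNIV) (walk_product N \<omega> k) L at_bot)
      \<and> (\<forall>k. N k \<omega> \<in> set_pmf \<mu>) \<and> (\<forall>\<sigma>\<in>set_pmf \<mu>. \<forall>m. \<exists>l\<le>m. N l \<omega> = \<sigma>)"
    using assms(2) AE_N_in_set_pmf by eventually_elim blast
  \<comment> \<open>A single sample point with all three properties is enough; the rest of the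
    argument is deterministic.\<close>
  from eventually_happens'[OF ae_filter_bot this] obtain \<omega> L
    where "limitin (discrete_topology UNIV) (walk_product N \<omega> k) L at_bot"
    and N: "\<forall>k. N k \<omega> \<in> set_pmf \<mu>"
    and rec: "\<forall>\<sigma>\<in>set_pmf \<mu>. \<forall>m. \<exists>l\<le>m. N l \<omega> = \<sigma>"
    by (elim exE conjE)
  then obtain m where L: "\<And>l. l \<le> m \<Longrightarrow> walk_product N \<omega> k l = L"
    unfolding limitin_discrete_topology_UNIV eventually_at_bot_linorder by blast
  have L_comp1: "L \<circ> \<sigma> = L" if "\<sigma> \<in> set_pmf \<mu>" for \<sigma>
  proof -
    \<comment> \<open>At an occurrence of \<open>\<sigma>\<close> early enough that the products
      have already settled, the products without and with this map are both
      \<open>L\<close>.\<close>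
    from rec[rule_format, OF that, of "min m k"] obtain l
      where l: "l \<le> min m k" "N l \<omega> = \<sigma>"
      by (elim exE conjE)
    have "walk_product N \<omega> k (l - 1) = walk_product N \<omega> k l \<circ> \<sigma>"
      using word_snoc[of l k N \<omega>] l by (simp add: walk_product_word)
    moreover have "walk_product N \<omega> k l = L" "walk_product N \<omega> k (l - 1) = L"
      using l by (auto intro!: L)
    ultimately show ?thesis by metis
  qed
  have L_comp: "L (compose_list \<sigma>s x) = L x" if "set \<sigma>s \<subseteq> set_pmf \<mu>" for \<sigma>s x
    using that
  proof (induction \<sigma>s)
    case (Cons \<sigma> \<sigma>s)
    then show ?case using fun_cong[OF L_comp1[of \<sigma>], of "compose_list \<sigma>s x"] by simp
  qed simp
  have "L x = L y" for x y
  proof -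
    obtain \<sigma>s where "set \<sigma>s \<subseteq> set_pmf \<mu>" "compose_list \<sigma>s x = y"
      using strongly_connected_imp_reachable[OF assms(1), of x y] unfolding reachable_def by blast
    then show ?thesis using L_comp[of \<sigma>s x] by simp
  qed
  then have "range L = {L undefined}" by blast
  \<comment> \<open>Going back at least to \<open>k - 1\<close> makes the word nonempty, as
    \<open>synchronizing\<close> demands.\<close>
  moreover have "L = compose_list (word N \<omega> k (min m (k - 1)))"
    using L[of "min m (k - 1)"] by (simp add: walk_product_word)
  moreover have "word N \<omega> k (min m (k - 1)) \<noteq> []"
    by (simp add: word_Cons)
  moreover have "set (word N \<omega> k (min m (k - 1))) \<subseteq> set_pmf \<mu>"
    using N by (auto simp: set_word)
  ultimately show ?thesis
    unfolding synchronizing_def by metis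
qed

lemma synchronizing_imp_strong:
  assumes "synchronizing (set_pmf \<mu>)"
  shows "strong M X N"
  unfolding strong_def
proof
  fix k
  let ?G = "generated_algebra (space M) {..k} N"
  \<comment> \<open>The number of maps, counted back from time \<open>k\<close>, after which the
    product is first constant. It depends only on \<open>N\<close> up to time \<open>k\<close>;
    where no product is constant it is a default value.\<close>
  define T where "T \<omega> = (LEAST n. \<exists>v. walk_product N \<omega> k (k - int n) = (\<lambda>_. v))" for \<omega>
  \<comment> \<open>The argument \<open>undefined\<close> is arbitrary: almost surely the product
    does not depend on it.\<close>
  define Y where "Y \<omega> = walk_product N \<omega> k (k - int (T \<omega>)) undefined" for \<omega>
  have [measurable]: "(\<lambda>\<omega>. word N \<omega> k l) \<in> measurable ?G (count_space UNIV)" for l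
    by (intro measurable_word measurable_generated_algebra) auto
  have T: "T \<in> measurable ?G (count_space UNIV)"
    unfolding T_def walk_product_word by measurable
  have "Y \<in> measurable ?G (count_space UNIV)"
    unfolding Y_def
    by (rule measurable_compose_countable'[OF _ T]) (auto simp: walk_product_word)
  moreover have "AE \<omega> in M. X k \<omega> = Y \<omega>"
    using AE_walk_product_const[OF assms, of k] AE_X_walk_product
  proof (eventually_elim)
    case (elim \<omega>)
    then obtain l v where l: "l \<le> k" "walk_product N \<omega> k l = (\<lambda>_. v)" by blast
    then have "walk_product N \<omega> k (k - int (nat (k - l))) = (\<lambda>_. v)" by simp
    then have "\<exists>n v. walk_product N \<omega> k (k - int n) = (\<lambda>_. v)" by blast
    then have "\<exists>v. walk_product N \<omega> k (k - int (T \<omega>)) = (\<lambda>_. v)"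
      unfolding T_def by (rule LeastI_ex)
    then obtain v' where v': "walk_product N \<omega> k (k - int (T \<omega>)) = (\<lambda>_. v')" by blast
    have "X k \<omega> = walk_product N \<omega> k (k - int (T \<omega>)) (X (k - int (T \<omega>)) \<omega>)"
      using elim(2) by simp
    then show "X k \<omega> = Y \<omega>" by (simp add: Y_def v')
  qed
  ultimately show "\<exists>Y\<in>measurable ?G (count_space UNIV). AE \<omega> in M. X k \<omega> = Y \<omega>" by blast
qed

section \<open>Approximation by events that depend on finitely many maps\<close>

text \<open>The approximable events contain the generators and are closed under complements and
  countable unions. Approximation is demanded for all \<open>l\<close> below a threshold so that
  finitely many events can be approximated with a common \<open>l\<close>.\<close>

lemma cylinder_approximation:
  assumes "A \<in> sets (generated_algebra (space M) {..k} N)" "\<delta> > 0"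
  shows "\<exists>l0. \<forall>l\<le>l0. \<exists>S. prob (sym_diff A {\<omega> \<in> space M. word N \<omega> k l \<in> S}) < \<delta>"
proof -
  define cyl where "cyl l S = {\<omega> \<in> space M. word N \<omega> k l \<in> S}" for l S
  have cyl [measurable]: "cyl l S \<in> events" for l S
    unfolding cyl_def by measurable
  let ?G = "{N j -` B \<inter> space M | j B. j \<in> {..k}}"
  have ev: "A \<in> events" if "A \<in> sigma_sets (space M) ?G" for A
    using that sets_generated_algebra_subset[of "{..k}" N M] N_measurable
    by (auto simp: sets_generated_algebra)
  have "A \<in> sigma_sets (space M) ?G"
    using assms(1) by (simp add: sets_generated_algebra)
  then have "\<exists>l0. \<forall>l\<le>l0. \<exists>S. prob (sym_diff A (cyl l S)) < \<delta>"
    using assms(2)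
  proof (induction arbitrary: \<delta> rule: sigma_sets.induct)
    case (Basic A)
    then obtain j B where A: "A = N j -` B \<inter> space M" and "j \<le> k" by auto
    have "\<exists>S. prob (sym_diff A (cyl l S)) < \<delta>" if "l \<le> j - 1" for l
    proof
      \<comment> \<open>Words start with the newest map, so \<open>N j\<close> stands at position
        \<open>nat (k - j)\<close> and the cylinder is exact.\<close>
      have "cyl l {\<sigma>s. \<sigma>s ! nat (k - j) \<in> B} = A"
        using \<open>j \<le> k\<close> that by (auto simp: A cyl_def nth_word)
      then show "prob (sym_diff A (cyl l {\<sigma>s. \<sigma>s ! nat (k - j) \<in> B})) < \<delta>"
        using Basic by simp
    qed
    then show ?case by blast
  next
    case Empty
    have "cyl l {} = {}" for l by (simp add: cyl_def)
    then show ?case using Empty by (metis Un_empty_left measure_empty Diff_cancel)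
  next
    case (Compl A)
    then obtain l0 where l0: "\<And>l. l \<le> l0 \<Longrightarrow> \<exists>S. prob (sym_diff A (cyl l S)) < \<delta>" by blast
    have "\<exists>S. prob (sym_diff (space M - A) (cyl l S)) < \<delta>" if l: "l \<le> l0" for l
    proof -
      obtain S where S: "prob (sym_diff A (cyl l S)) < \<delta>" using l0[OF l] by blast
      have "A \<subseteq> space M" using ev[OF Compl.hyps] sets.sets_into_space by blast
      then have "sym_diff (space M - A) (cyl l (- S)) = sym_diff A (cyl l S)"
        by (auto simp: cyl_def)
      with S show ?thesis by metis
    qed
    then show ?case by blast
  next
    case (Union A)
    have A [measurable]: "A i \<in> events" for i using ev[OF Union.hyps] .
    \<comment> \<open>Half of \<open>\<delta>\<close> is spent on cutting the union down to finitely
      many events, the other half on approximating these.\<close>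
    have "(\<Union>n. \<Union>i<n. A i) = (\<Union>i. A i)" by blast
    moreover have "incseq (\<lambda>n. \<Union>i<n. A i)"
      by (intro monoI UN_mono) auto
    then have "(\<lambda>n. prob (\<Union>i<n. A i)) \<longlonglongrightarrow> prob (\<Union>n. \<Union>i<n. A i)"
      by (intro finite_Lim_measure_incseq) auto
    ultimately have "(\<lambda>n. prob (\<Union>i<n. A i)) \<longlonglongrightarrow> prob (\<Union>i. A i)" by simp
    from LIMSEQ_D[OF this, of "\<delta> / 2"] obtain n
      where "norm (prob (\<Union>i<n. A i) - prob (\<Union>i. A i)) < \<delta> / 2"
      using Union.prems by auto
    then have "prob (\<Union>i. A i) - prob (\<Union>i<n. A i) < \<delta> / 2"
      unfolding real_norm_def by linarith
    moreover have "prob ((\<Union>i. A i) - (\<Union>i<n. A i)) = prob (\<Union>i. A i) - prob (\<Union>i<n. A i)"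
      by (rule finite_measure_Diff) auto
    ultimately have n: "prob ((\<Union>i. A i) - (\<Union>i<n. A i)) < \<delta> / 2" by simp
    \<comment> \<open>The \<open>n\<close> errors add up to at most \<open>\<delta> / 2\<close>; the
      added 1 avoids a division by zero for \<open>n = 0\<close>, just as the inserted 0 below keeps
      the minimum defined.\<close>
    define \<eta> where "\<eta> = \<delta> / (2 * (real n + 1))"
    have "\<eta> > 0" using Union.prems by (simp add: \<eta>_def)
    then have "\<exists>l0. \<forall>l\<le>l0. \<exists>S. prob (sym_diff (A i) (cyl l S)) < \<eta>" for i
      by (rule Union.IH)
    then obtain l0 where l0: "\<And>i l. l \<le> l0 i \<Longrightarrow> \<exists>S. prob (sym_diff (A i) (cyl l S)) < \<eta>"
      by metis
    define m where "m = Min (insert 0 (l0 ` {..<n}))"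
    have "\<exists>S. prob (sym_diff (\<Union>i. A i) (cyl l S)) < \<delta>" if "l \<le> m" for l
    proof -
      have "l \<le> l0 i" if "i < n" for i
      proof -
        have "m \<le> l0 i" unfolding m_def using that by (intro Min_le) auto
        with \<open>l \<le> m\<close> show ?thesis by simp
      qed
      then have "\<forall>i\<in>{..<n}. \<exists>S. prob (sym_diff (A i) (cyl l S)) < \<eta>" using l0 by blast
      then obtain S where S: "\<And>i. i < n \<Longrightarrow> prob (sym_diff (A i) (cyl l (S i))) < \<eta>"
        by (metis lessThan_iff)
      have "cyl l (\<Union>i<n. S i) = (\<Union>i<n. cyl l (S i))" by (auto simp: cyl_def)
      then have "sym_diff (\<Union>i. A i) (cyl l (\<Union>i<n. S i)) \<subseteq>
          ((\<Union>i. A i) - (\<Union>i<n. A i)) \<union> (\<Union>i<n. sym_diff (A i) (cyl l (S i)))"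
        by auto
      then have "prob (sym_diff (\<Union>i. A i) (cyl l (\<Union>i<n. S i))) \<le>
          prob (((\<Union>i. A i) - (\<Union>i<n. A i)) \<union> (\<Union>i<n. sym_diff (A i) (cyl l (S i))))"
        by (rule finite_measure_mono) measurable
      also have "\<dots> \<le> prob ((\<Union>i. A i) - (\<Union>i<n. A i)) + prob (\<Union>i<n. sym_diff (A i) (cyl l (S i)))"
        by (rule measure_Un_le) measurable
      also have "\<dots> \<le> prob ((\<Union>i. A i) - (\<Union>i<n. A i)) + (\<Sum>i<n. prob (sym_diff (A i) (cyl l (S i))))"
        by (intro add_left_mono finite_measure_subadditive_finite) auto
      also have "\<dots> \<le> prob ((\<Union>i. A i) - (\<Union>i<n. A i)) + (\<Sum>i<n. \<eta>)"
        by (intro add_left_mono sum_mono) (use S less_imp_le in auto)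
      also have "\<dots> \<le> prob ((\<Union>i. A i) - (\<Union>i<n. A i)) + \<delta> / 2"
        using Union.prems by (simp add: \<eta>_def field_simps)
      finally show ?thesis using n by (intro exI[of _ "\<Union>i<n. S i"]) simp
    qed
    then show ?case by blast
  qed
  then show ?thesis by (simp add: cyl_def)
qed

section \<open>From strong walks to synchronization\<close>

text \<open>From any value \<open>u\<close> at time \<open>k - n\<close> a fixed word of length
  \<open>n\<close> leads to \<open>v\<close>. Its probability depends only on \<open>u\<close> and
  \<open>v\<close>, so the minimum over the finitely many pairs is a bound for all times.\<close>

lemma X_law_lower_bound:
  assumes "strongly_connected (adjacency \<mu>)" "aperiodic (adjacency \<mu>)"
  shows "\<exists>\<epsilon>>0. \<forall>k v. prob {\<omega> \<in> space M. X k \<omega> = v} \<ge> \<epsilon>"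
proof -
  obtain n where "\<And>x y. reachable \<mu> n x y"
    using ex_reachable_uniform[OF assms] by blast
  then obtain \<sigma>s where len: "\<And>x y. length (\<sigma>s x y) = n"
    and supp: "\<And>x y. set (\<sigma>s x y) \<subseteq> set_pmf \<mu>"
    and comp: "\<And>x y. compose_list (\<sigma>s x y) x = y"
    unfolding reachable_def by metis
  define c where "c = (\<lambda>(x, y). prod_list (map (pmf \<mu>) (\<sigma>s x y)))"
  define \<epsilon> where "\<epsilon> = Min (range c)"
  have "\<epsilon> > 0"
    unfolding \<epsilon>_def by (subst Min_gr_iff) (auto simp: c_def prod_list_pmf_pos[OF supp])
  moreover have "prob {\<omega> \<in> space M. X k \<omega> = v} \<ge> \<epsilon>" for k v
  proof -
    let ?l = "k - int n"
    let ?X = "\<lambda>u. {\<omega> \<in> space M. X ?l \<omega> = u}"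
    let ?B = "\<lambda>u. ?X u \<inter> {\<omega> \<in> space M. word N \<omega> k ?l = \<sigma>s u v}"
    have "?X u \<in> sets (past ?l)" for u
      using measurable_sets[OF measurable_past(1)[of ?l ?l], of "{u}"]
      by (simp add: vimage_def Int_def conj_commute)
    then have B: "prob (?B u) = prob (?X u) * c (u, v)" for u
      using prob_word[of "?X u" ?l "\<sigma>s u v"] by (simp add: len c_def)
    have "(\<Union>u. ?X u) = space M" by blast
    then have "1 = prob (\<Union>u\<in>UNIV. ?X u)" by (simp add: prob_space)
    also have "\<dots> = (\<Sum>u\<in>UNIV. prob (?X u))"
      by (intro finite_measure_finite_Union) (auto simp: disjoint_family_on_def)
    \<comment> \<open>The bound is distributed over the possible values of \<open>X\<close> at time
      \<open>k - n\<close>, each of which is then continued by its own word to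
      \<open>v\<close>.\<close>
    finally have "\<epsilon> = (\<Sum>u\<in>UNIV. prob (?X u) * \<epsilon>)"
      by (simp flip: sum_distrib_right)
    also have "\<dots> \<le> (\<Sum>u\<in>UNIV. prob (?B u))"
      unfolding B by (intro sum_mono mult_left_mono) (auto simp: \<epsilon>_def)
    also have "\<dots> = prob (\<Union>u\<in>UNIV. ?B u)"
      by (intro finite_measure_finite_Union[symmetric]) (auto simp: disjoint_family_on_def)
    also have "\<dots> \<le> prob {\<omega> \<in> space M. X k \<omega> = v}"
    proof (rule finite_measure_mono_AE)
      show "AE \<omega> in M. \<omega> \<in> (\<Union>u\<in>UNIV. ?B u) \<longrightarrow> \<omega> \<in> {\<omega> \<in> space M. X k \<omega> = v}"
        using AE_X_walk_product
      proof eventually_elim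
        case (elim \<omega>)
        then have "X k \<omega> = compose_list (word N \<omega> k ?l) (X ?l \<omega>)"
          by (simp add: walk_product_word)
        then show ?case by (auto simp: comp)
      qed
    qed measurable
    finally show ?thesis .
  qed
  ultimately show ?thesis by blast
qed

lemma strong_imp_synchronizing:
  assumes "strongly_connected (adjacency \<mu>)" "aperiodic (adjacency \<mu>)" "strong M X N"
  shows "synchronizing (set_pmf \<mu>)"
proof (rule ccontr)
  assume not_sync: "\<not> synchronizing (set_pmf \<mu>)"
  obtain \<epsilon> where "\<epsilon> > 0" and \<epsilon>: "\<And>k v. prob {\<omega> \<in> space M. X k \<omega> = v} \<ge> \<epsilon>"
    using X_law_lower_bound[OF assms(1,2)] by blast
  obtain Y where Y: "Y \<in> measurable (generated_algebra (space M) {..0} N) (count_space UNIV)"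
    and XY: "AE \<omega> in M. X 0 \<omega> = Y \<omega>"
    using assms(3) unfolding strong_def by blast
  fix v :: 'v
  let ?A = "Y -` {v} \<inter> space M"
  have A: "?A \<in> sets (generated_algebra (space M) {..0} N)"
    using measurable_sets[OF Y, of "{v}"] by simp
  then have A_ev [measurable]: "?A \<in> events"
    using sets_generated_algebra_subset[of "{..0}" N M] N_measurable by blast
  obtain l0 where "\<And>l. l \<le> l0 \<Longrightarrow> \<exists>S. prob (sym_diff ?A {\<omega> \<in> space M. word N \<omega> 0 l \<in> S}) < \<epsilon> * \<epsilon>"
    using cylinder_approximation[OF A, of "\<epsilon> * \<epsilon>"] \<open>\<epsilon> > 0\<close> by auto
  \<comment> \<open>A negative \<open>l\<close> makes the words nonempty, so that the failure of
    \<open>synchronizing\<close> applies to them.\<close>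
  moreover define l where "l = min l0 (- 1)"
  then have "l \<le> l0" "l < 0" by auto
  ultimately obtain S where S: "prob (sym_diff ?A {\<omega> \<in> space M. word N \<omega> 0 l \<in> S}) < \<epsilon> * \<epsilon>"
    by blast
  define n where "n = nat (- l)"
  have n: "n > 0" "l + int n = 0" using \<open>l < 0\<close> by (auto simp: n_def)
  \<comment> \<open>Almost surely \<open>X 0\<close> can be \<open>v\<close> only if the word read
    lies in \<open>W\<close>; hence \<open>W\<close> has probability at least
    \<open>\<epsilon>\<close>.\<close>
  define W where "W = {\<sigma>s. length \<sigma>s = n \<and> set \<sigma>s \<subseteq> set_pmf \<mu> \<and> v \<in> range (compose_list \<sigma>s)}"
  have "finite W"
    by (rule finite_subset[OF _ finite_lists_length_eq[of "UNIV :: ('v \<Rightarrow> 'v) set" n]]) (auto simp: W_def)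
  \<comment> \<open>A start that refutes the prediction of \<open>S\<close>: if \<open>S\<close>
    predicts \<open>v\<close>, some vertex is sent elsewhere because the product is not constantly
    \<open>v\<close>; otherwise some vertex is sent to \<open>v\<close> because \<open>v\<close> is
    in the range.\<close>
  have "\<exists>u. \<sigma>s \<in> S \<longleftrightarrow> compose_list \<sigma>s u \<noteq> v" if "\<sigma>s \<in> W" for \<sigma>s
  proof -
    have "range (compose_list \<sigma>s) \<noteq> {v}" "v \<in> range (compose_list \<sigma>s)"
      using not_sync that \<open>n > 0\<close> unfolding synchronizing_def W_def by auto
    then show ?thesis by fastforce
  qed
  then obtain u where u: "\<And>\<sigma>s. \<sigma>s \<in> W \<Longrightarrow> \<sigma>s \<in> S \<longleftrightarrow> compose_list \<sigma>s (u \<sigma>s) \<noteq> v"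
    by metis
  let ?X = "\<lambda>x. {\<omega> \<in> space M. X l \<omega> = x}"
  let ?W = "\<lambda>\<sigma>s. {\<omega> \<in> space M. word N \<omega> 0 l = \<sigma>s}"
  have X_past: "?X x \<in> sets (past l)" for x
    using measurable_sets[OF measurable_past(1)[of l l], of "{x}"]
    by (simp add: vimage_def Int_def conj_commute)
  have prob_W: "prob (B \<inter> ?W \<sigma>s) = prob B * prod_list (map (pmf \<mu>) \<sigma>s)"
    if "\<sigma>s \<in> W" "B \<in> sets (past l)" for \<sigma>s B
    using prob_word[OF that(2), of \<sigma>s] that(1) n by (simp add: W_def)
  have "\<epsilon> \<le> prob {\<omega> \<in> space M. X 0 \<omega> = v}"
    by (rule \<epsilon>)
  also have "\<dots> \<le> prob (\<Union>\<sigma>s\<in>W. ?W \<sigma>s)"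
  proof (rule finite_measure_mono_AE)
    show "AE \<omega> in M. \<omega> \<in> {\<omega> \<in> space M. X 0 \<omega> = v} \<longrightarrow> \<omega> \<in> (\<Union>\<sigma>s\<in>W. ?W \<sigma>s)"
      using AE_X_walk_product AE_N_in_set_pmf
    proof eventually_elim
      case (elim \<omega>)
      have "X 0 \<omega> = compose_list (word N \<omega> 0 l) (X l \<omega>)"
        using elim(1) \<open>l < 0\<close> by (simp add: walk_product_word)
      moreover have "set (word N \<omega> 0 l) \<subseteq> set_pmf \<mu>"
        using elim(2) by (auto simp: set_word)
      ultimately have "word N \<omega> 0 l \<in> W" if "X 0 \<omega> = v"
        using that by (simp add: W_def n_def)
      then show ?case by simp
    qed
    show "(\<Union>\<sigma>s\<in>W. ?W \<sigma>s) \<in> events"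
      using \<open>finite W\<close> by (intro sets.finite_UN) auto
  qed
  also have "\<dots> = (\<Sum>\<sigma>s\<in>W. prob (?W \<sigma>s))"
    using \<open>finite W\<close> by (intro finite_measure_finite_Union) (auto simp: disjoint_family_on_def)
  also have "\<dots> = (\<Sum>\<sigma>s\<in>W. prod_list (map (pmf \<mu>) \<sigma>s))"
  proof (rule sum.cong[OF refl])
    fix \<sigma>s assume "\<sigma>s \<in> W"
    moreover have "space M \<inter> ?W \<sigma>s = ?W \<sigma>s" by blast
    moreover have "space M \<in> sets (past l)" using sets.top[of "past l"] by simp
    ultimately show "prob (?W \<sigma>s) = prod_list (map (pmf \<mu>) \<sigma>s)"
      using prob_W[of \<sigma>s "space M"] by (simp add: prob_space)
  qed
  \<comment> \<open>One factor bounds the probability of \<open>W\<close>, the other the probability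
    that \<open>X l\<close>, independently of the word, is the refuting start
    \<open>u \<sigma>s\<close>.\<close>
  finally have "\<epsilon> * \<epsilon> \<le> (\<Sum>\<sigma>s\<in>W. \<epsilon> * prod_list (map (pmf \<mu>) \<sigma>s))"
    using \<open>\<epsilon> > 0\<close> by (simp flip: sum_distrib_left)
  also have "\<dots> \<le> (\<Sum>\<sigma>s\<in>W. prob (?X (u \<sigma>s)) * prod_list (map (pmf \<mu>) \<sigma>s))"
    using \<epsilon> by (intro sum_mono mult_right_mono) (auto simp: W_def intro: less_imp_le prod_list_pmf_pos)
  also have "\<dots> = (\<Sum>\<sigma>s\<in>W. prob (?X (u \<sigma>s) \<inter> ?W \<sigma>s))"
    by (intro sum.cong) (simp_all add: prob_W X_past)
  also have "\<dots> = prob (\<Union>\<sigma>s\<in>W. ?X (u \<sigma>s) \<inter> ?W \<sigma>s)"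
    using \<open>finite W\<close> by (intro finite_measure_finite_Union[symmetric]) (auto simp: disjoint_family_on_def)
  also have "\<dots> \<le> prob (sym_diff ?A {\<omega> \<in> space M. word N \<omega> 0 l \<in> S})"
  proof (rule finite_measure_mono_AE)
    show "AE \<omega> in M. \<omega> \<in> (\<Union>\<sigma>s\<in>W. ?X (u \<sigma>s) \<inter> ?W \<sigma>s) \<longrightarrow>
        \<omega> \<in> sym_diff ?A {\<omega> \<in> space M. word N \<omega> 0 l \<in> S}"
      using AE_X_walk_product XY
    proof eventually_elim
      case (elim \<omega>)
      have "X 0 \<omega> = compose_list (word N \<omega> 0 l) (X l \<omega>)"
        using elim(1) \<open>l < 0\<close> by (simp add: walk_product_word)
      with elim(2) have "Y \<omega> = compose_list (word N \<omega> 0 l) (X l \<omega>)" by simp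
      then show ?case using u[of "word N \<omega> 0 l"] by auto
    qed
  qed measurable
  also have "\<dots> < \<epsilon> * \<epsilon>" by (rule S)
  finally show False using \<open>\<epsilon> > 0\<close> by simp
qed

end

theorem theorem1p3:
  fixes M :: "'w measure"
    and \<mu> :: "('v::finite \<Rightarrow> 'v) pmf"
    and X :: "int \<Rightarrow> 'w \<Rightarrow> 'v"
    and N :: "int \<Rightarrow> 'w \<Rightarrow> 'v \<Rightarrow> 'v"
  assumes "random_walk M \<mu> X N"
    and "constant_outdegree (adjacency \<mu>)"
    and "strongly_connected (adjacency \<mu>)"
    and "aperiodic (adjacency \<mu>)"
  shows "(synchronizing (set_pmf \<mu>) \<longleftrightarrow>
           (\<forall>k. AE \<omega> in M. \<exists>L. limitin (discrete_topology UNIV) (walk_product N \<omega> k) L at_bot))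
       \<and> ((\<forall>k. AE \<omega> in M. \<exists>L. limitin (discrete_topology UNIV) (walk_product N \<omega> k) L at_bot) \<longleftrightarrow>
           strong M X N)"
proof -
  interpret random_walk M \<mu> X N by (rule assms(1))
  show ?thesis
    using synchronizing_imp_limit limit_imp_synchronizing[OF assms(3)]
      synchronizing_imp_strong strong_imp_synchronizing[OF assms(3,4)] by blast
qed

end
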